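(* Suppose that every finite simple graph that contains no triangle, no ISK4 and no $K_{3,3}$ (as induced subgraphs) has a vertex of degree at most $2$. Then every finite simple graph that contains no triangle and no ISK4 is $3$-colorable.
   Context: $G$ contains $H$ if $H$ is isomorphic to an induced subgraph of $G$. A subdivision of a graph is obtained by repeatedly replacing an edge $vw$ by a path $vuw$ through a new vertex $u$. An ISK4 of $G$ is an induced subgraph of $G$ that is a subdivision of $K_4$. $K_{3,3}$ is the complete bipartite graph with both sides of size 3. *)

theory Defs
  imports "Graph_Theory.Graph_Theory"
begin

text \<open>
  A finite simple graph is a \<^const>\<open>pair_graph\<close>: a finite, loop-free, symmetric digraph whose arcs
  are pairs of vertices, an edge being a pair of opposite arcs.  The null graph is allowed.
\<close>

text \<open>
  The predicates for complete and complete bipartite graphs are closed under isomorphism, so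
  ``\<open>G\<close> contains \<open>K\<^bsub>3,3\<^esub>\<close>'' means that some induced subgraph of \<open>G\<close> satisfies the predicate.
\<close>

definition contains_triangle :: "'a pair_pre_digraph \<Rightarrow> bool" where
  "contains_triangle G \<longleftrightarrow>
     (\<exists>H :: 'a pair_pre_digraph. induced_subgraph (with_proj H) (with_proj G) \<and> K\<^bsub>3\<^esub> (with_proj H))"

definition contains_K33 :: "'a pair_pre_digraph \<Rightarrow> bool" where
  "contains_K33 G \<longleftrightarrow>
     (\<exists>H :: 'a pair_pre_digraph. induced_subgraph (with_proj H) (with_proj G) \<and> K\<^bsub>3,3\<^esub> (with_proj H))"

text \<open>
  A subdivision keeps the vertices of the graph it starts from, so the \<open>K\<^sub>4\<close> that is subdivided
  can be taken on the vertex type of \<open>H\<close>.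
\<close>

definition ISK4_of :: "'a pair_pre_digraph \<Rightarrow> 'a pair_pre_digraph \<Rightarrow> bool" where
  "ISK4_of H G \<longleftrightarrow> induced_subgraph (with_proj H) (with_proj G) \<and>
     (\<exists>K :: 'a pair_pre_digraph. K\<^bsub>4\<^esub> (with_proj K) \<and> subdivision_pair K H)"

definition contains_ISK4 :: "'a pair_pre_digraph \<Rightarrow> bool" where
  "contains_ISK4 G \<longleftrightarrow> (\<exists>H. ISK4_of H G)"

text \<open>Every edge at \<open>v\<close> gives exactly one arc leaving \<open>v\<close>.\<close>

definition degree :: "'a pair_pre_digraph \<Rightarrow> 'a \<Rightarrow> nat" where
  "degree G v = out_degree (with_proj G) v"

definition colorable :: "nat \<Rightarrow> 'a pair_pre_digraph \<Rightarrow> bool" where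
  "colorable k G \<longleftrightarrow>
     (\<exists>c :: 'a \<Rightarrow> nat. (\<forall>v \<in> pverts G. c v < k) \<and> (\<forall>(u, v) \<in> parcs G. c u \<noteq> c v))"

end

theory Submission
  imports Defs
begin

text \<open>
  Induct on the number of vertices; an injection into the natural numbers makes the hypothesis
  applicable.  A graph without \<open>K\<^bsub>3,3\<^esub>\<close> has a vertex of degree at most 2, and a 3-coloring of the rest
  extends to it.  Otherwise take a maximal complete bipartite subgraph with sides \<open>A\<close>, \<open>B\<close> of
  size at least 3; triangle-freeness makes it induced.  Suppose that a walk through vertices
  outside \<open>A \<union> B\<close> links two distinct vertices of one side.  A shortest such walk is an induced path,
  say from \<open>x\<close> to \<open>y\<close> in \<open>A\<close>, and together with a third vertex of \<open>A\<close> and two vertices of \<open>B\<close> that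
  have no neighbor in its interior it induces a subdivision of \<open>K\<^sub>4\<close>: the third vertex subdivides the
  edge opposite to the one replaced by the path.  Hence every component of the graph outside
  \<open>A \<union> B\<close> attaches to at most one vertex of each side, that is, to a clique, and 3-colorings of the
  two sides of this clique cutset can be matched by permuting colors.
\<close>

subsection \<open>Induced subgraphs\<close>

lemma induced_subgraph_trans:
  assumes "induced_subgraph H I" "induced_subgraph I G"
  shows "induced_subgraph H G"
proof -
  have "subgraph H G"
    using assms by (meson induced_imp_subgraph subgraph_trans)
  moreover have "arcs H = {e \<in> arcs G. tail G e \<in> verts H \<and> head G e \<in> verts H}"
    using assms by (auto simp: induced_subgraph_def subgraph_def compatible_def)
  ultimately show ?thesis
    by (simp add: induced_subgraph_def)
qed

definition pair_induce_subgraph :: "'a pair_pre_digraph \<Rightarrow> 'a set \<Rightarrow> 'a pair_pre_digraph"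
    (infix \<open>\<restriction>\<^sub>p\<close> 67) where
  "G \<restriction>\<^sub>p S = \<lparr>pverts = S, parcs = parcs G \<inter> S \<times> S\<rparr>"

lemma pair_induce_subgraph_simps [simp]:
  "pverts (G \<restriction>\<^sub>p S) = S"
  "parcs (G \<restriction>\<^sub>p S) = parcs G \<inter> S \<times> S"
  by (simp_all add: pair_induce_subgraph_def)

lemma with_proj_pair_induce_subgraph: "with_proj (G \<restriction>\<^sub>p S) = with_proj G \<restriction> S"
  by (auto simp: with_proj_def induce_subgraph_def)

lemma (in pair_wf_digraph) induced_subgraph_pair_iff:
  "induced_subgraph (with_proj H) (with_proj G) \<longleftrightarrow> pverts H \<subseteq> pverts G \<and> H = G \<restriction>\<^sub>p pverts H"
proof
  assume "induced_subgraph (with_proj H) (with_proj G)"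
  then show "pverts H \<subseteq> pverts G \<and> H = G \<restriction>\<^sub>p pverts H"
    by (auto simp: induced_subgraph_def subgraph_def intro!: pair_pre_digraph.equality)
next
  assume H: "pverts H \<subseteq> pverts G \<and> H = G \<restriction>\<^sub>p pverts H"
  then have "induced_subgraph (with_proj G \<restriction> pverts H) (with_proj G)"
    by (intro induced_induce) simp
  with H show "induced_subgraph (with_proj H) (with_proj G)"
    by (metis with_proj_pair_induce_subgraph)
qed

lemma (in pair_graph) induced_subgraph_pair_induce:
  "S \<subseteq> pverts G \<Longrightarrow> induced_subgraph (with_proj (G \<restriction>\<^sub>p S)) (with_proj G)"
  by (simp add: induced_subgraph_pair_iff)

lemma (in pair_graph) pair_graph_pair_induce_subgraph:
  assumes "S \<subseteq> pverts G"
  shows "pair_graph (G \<restriction>\<^sub>p S)"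
proof
  show "finite (pverts (G \<restriction>\<^sub>p S))" "finite (parcs (G \<restriction>\<^sub>p S))"
    using assms finite_subset[OF _ pair_finite_verts] pair_finite_arcs by auto
  show "symmetric (G \<restriction>\<^sub>p S)"
    using arcs_symmetric by (auto simp: symmetric_def intro: symI)
qed (auto dest: pair_no_loops)

lemma (in pair_graph) card_psubset_pverts: "S \<subset> pverts G \<Longrightarrow> card S < card (pverts G)"
  using pair_finite_verts by (rule psubset_card_mono)

lemma contains_triangle_induced_subgraph:
  assumes "induced_subgraph (with_proj H) (with_proj G)" "contains_triangle H"
  shows "contains_triangle G"
  using assms induced_subgraph_trans unfolding contains_triangle_def by blast

lemma contains_ISK4_induced_subgraph:
  assumes "induced_subgraph (with_proj H) (with_proj G)" "contains_ISK4 H"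
  shows "contains_ISK4 G"
  using assms induced_subgraph_trans unfolding contains_ISK4_def ISK4_of_def by blast

subsection \<open>Colorings\<close>

definition coloring :: "nat \<Rightarrow> 'a pair_pre_digraph \<Rightarrow> ('a \<Rightarrow> nat) \<Rightarrow> bool" where
  "coloring k G c \<longleftrightarrow> c ` pverts G \<subseteq> {..<k} \<and> (\<forall>(u, v) \<in> parcs G. c u \<noteq> c v)"

lemma colorable_iff_coloring: "colorable k G \<longleftrightarrow> (\<exists>c. coloring k G c)"
  unfolding colorable_def coloring_def by (simp add: image_subset_iff)

lemma colorable_bipartition:
  assumes "pverts G = A \<union> B" "A \<inter> B = {}" "parcs G \<subseteq> A \<times> B \<union> B \<times> A" "2 \<le> k"
  shows "colorable k G"
proof -
  have "u \<in> A \<longleftrightarrow> v \<notin> A" if "(u, v) \<in> parcs G" for u v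
    using that assms(2,3) by blast
  then have "coloring k G (\<lambda>v. if v \<in> A then 0 else 1)"
    using assms(4) by (auto simp: coloring_def)
  then show ?thesis
    unfolding colorable_iff_coloring by blast
qed

lemma degree_eq_card_Image: "degree G v = card (parcs G `` {v})"
proof -
  have "out_arcs (with_proj G) v = Pair v ` (parcs G `` {v})"
    by (auto simp: out_arcs_def)
  then show ?thesis
    by (simp add: degree_def out_degree_def card_image inj_on_def)
qed

lemma (in pair_graph) colorable_null:
  assumes "pverts G = {}"
  shows "colorable k G"
proof -
  have "parcs G = {}"
    using assms wellformed' by auto
  with assms show ?thesis
    by (simp add: colorable_def)
qed

lemma (in pair_graph) colorable_remove_vertex:
  assumes "degree G v < k" and "colorable k (G \<restriction>\<^sub>p (pverts G - {v}))"
  shows "colorable k G"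
proof -
  let ?N = "parcs G `` {v}"
  obtain c where c: "coloring k (G \<restriction>\<^sub>p (pverts G - {v})) c"
    using assms(2) unfolding colorable_iff_coloring by blast
  have "finite ?N"
    using pair_finite_arcs by (rule finite_Image)
  then have "card (c ` ?N) < card {..<k}"
    using assms(1) card_image_le[of ?N c] by (simp add: degree_eq_card_Image)
  then obtain j where j: "j < k" "j \<notin> c ` ?N"
    using card_mono[of "c ` ?N" "{..<k}"] \<open>finite ?N\<close> by fastforce
  have "(c(v := j)) x \<noteq> (c(v := j)) y" if xy: "(x, y) \<in> parcs G" for x y
  proof -
    consider "x = v" "y \<in> ?N" "y \<noteq> v" | "y = v" "x \<in> ?N" "x \<noteq> v" | "x \<noteq> v" "y \<noteq> v"
      using xy arcs_symmetric[OF xy] no_loops'[OF xy] by auto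
    then show ?thesis
      using j(2) c xy wellformed'[OF xy] by cases (auto simp: coloring_def)
  qed
  moreover have "(c(v := j)) ` pverts G \<subseteq> {..<k}"
    using c j(1) by (auto simp: coloring_def)
  ultimately show ?thesis
    unfolding colorable_iff_coloring coloring_def by blast
qed

lemma inj_on_extends_to_bij_betw:
  assumes "finite X" "Y \<subseteq> X" "inj_on f Y" "f ` Y \<subseteq> X"
  obtains p where "bij_betw p X X" "\<And>y. y \<in> Y \<Longrightarrow> p y = f y"
proof -
  have "card (X - Y) = card (X - f ` Y)"
    using assms by (simp add: card_Diff_subset card_image finite_subset)
  then obtain q where q: "bij_betw q (X - Y) (X - f ` Y)"
    using assms(1) by (meson finite_Diff finite_same_card_bij)
  define p where "p x = (if x \<in> Y then f x else q x)" for x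
  have "bij_betw p Y (f ` Y)"
    using assms(3) by (auto simp: p_def bij_betw_def inj_on_def)
  moreover have "bij_betw p (X - Y) (X - f ` Y)"
    using q by (rule bij_betw_cong[THEN iffD1, rotated]) (simp add: p_def)
  ultimately have "bij_betw p (Y \<union> (X - Y)) (f ` Y \<union> (X - f ` Y))"
    by (rule bij_betw_combine) auto
  then have "bij_betw p X X"
    using assms(2,4) by (simp add: Un_absorb1)
  then show thesis
    by (rule that) (simp add: p_def)
qed

lemma coloring_comp_bij_betw:
  assumes c: "coloring k G c" and p: "bij_betw p {..<k} {..<k}"
    and G: "parcs G \<subseteq> pverts G \<times> pverts G"
  shows "coloring k G (p \<circ> c)"
proof -
  have "p (c u) \<noteq> p (c v)" if "(u, v) \<in> parcs G" for u v
  proof -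
    have "c u \<in> {..<k}" "c v \<in> {..<k}" "c u \<noteq> c v"
      using that c G by (auto simp: coloring_def)
    then show ?thesis
      using p by (auto simp: bij_betw_def dest: inj_onD)
  qed
  moreover have "(p \<circ> c) ` pverts G \<subseteq> {..<k}"
    using c p by (auto simp: coloring_def bij_betw_def)
  ultimately show ?thesis
    by (auto simp: coloring_def)
qed

definition clique :: "'a pair_pre_digraph \<Rightarrow> 'a set \<Rightarrow> bool" where
  "clique G K \<longleftrightarrow> (\<forall>u \<in> K. \<forall>v \<in> K. u \<noteq> v \<longrightarrow> (u, v) \<in> parcs G)"

definition separation :: "'a pair_pre_digraph \<Rightarrow> 'a set \<Rightarrow> 'a set \<Rightarrow> bool" where
  "separation G S T \<longleftrightarrow> pverts G = S \<union> T \<and> parcs G \<subseteq> S \<times> S \<union> T \<times> T"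

lemma coloring_separation:
  assumes "separation G S T" "coloring k (G \<restriction>\<^sub>p S) c" "coloring k (G \<restriction>\<^sub>p T) d"
    and "\<And>v. v \<in> S \<inter> T \<Longrightarrow> d v = c v"
  shows "coloring k G (\<lambda>v. if v \<in> S then c v else d v)"
proof -
  define e where "e = (\<lambda>v. if v \<in> S then c v else d v)"
  have eS: "e v = c v" if "v \<in> S" for v
    using that by (simp add: e_def)
  have eT: "e v = d v" if "v \<in> T" for v
    using that assms(4) by (simp add: e_def)
  have "e u \<noteq> e v" if uv: "(u, v) \<in> parcs G" for u v
  proof -
    consider "u \<in> S" "v \<in> S" | "u \<in> T" "v \<in> T"
      using uv assms(1) by (auto simp: separation_def)
    then show ?thesis
      using uv assms(2,3) by cases (auto simp: coloring_def eS eT)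
  qed
  moreover have "e ` pverts G \<subseteq> {..<k}"
    using assms(1-3) by (auto simp: coloring_def separation_def e_def)
  ultimately have "coloring k G e"
    by (auto simp: coloring_def)
  then show ?thesis
    unfolding e_def .
qed

lemma coloring_inj_on_clique:
  assumes "coloring k G c" "clique G K"
  shows "inj_on c K"
  using assms unfolding coloring_def clique_def inj_on_def by blast

lemma clique_pair_induce_subgraph:
  assumes "clique G K" "K \<subseteq> S"
  shows "clique (G \<restriction>\<^sub>p S) K"
  using assms by (auto simp: clique_def)

lemma colorable_clique_separation:
  assumes sep: "separation G S T" and clique: "clique G (S \<inter> T)"
    and "colorable k (G \<restriction>\<^sub>p S)" "colorable k (G \<restriction>\<^sub>p T)"
  shows "colorable k G"
proof -
  let ?K = "S \<inter> T"
  obtain c d where c: "coloring k (G \<restriction>\<^sub>p S) c" and d: "coloring k (G \<restriction>\<^sub>p T) d"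
    using assms(3,4) unfolding colorable_iff_coloring by blast
  have inj: "inj_on c ?K" "inj_on d ?K"
    using c d clique by (auto intro: coloring_inj_on_clique clique_pair_induce_subgraph)
  have "inj_on (c \<circ> inv_into ?K d) (d ` ?K)"
    using inj(1) by (intro comp_inj_on inj_on_inv_into) (simp_all add: image_inv_into_cancel inj(2))
  moreover have "d ` ?K \<subseteq> {..<k}" "(c \<circ> inv_into ?K d) ` d ` ?K \<subseteq> {..<k}"
    using c d inj(2) by (auto simp: coloring_def)
  ultimately obtain p where p: "bij_betw p {..<k} {..<k}"
    and "\<And>i. i \<in> d ` ?K \<Longrightarrow> p i = (c \<circ> inv_into ?K d) i"
    using inj_on_extends_to_bij_betw[of "{..<k}"] by blast
  then have "(p \<circ> d) v = c v" if "v \<in> ?K" for v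
    using that inj(2) by simp
  moreover have "coloring k (G \<restriction>\<^sub>p T) (p \<circ> d)"
    using d p by (rule coloring_comp_bij_betw) auto
  ultimately show ?thesis
    using coloring_separation[OF sep c] unfolding colorable_iff_coloring by blast
qed

lemma (in pair_graph) separation_Image:
  assumes "C \<subseteq> pverts G"
  shows "separation G (pverts G - C) (C \<union> parcs G `` C)"
proof -
  have "parcs G `` C \<subseteq> pverts G"
    using wellformed' by auto
  moreover have "(u, v) \<in> (pverts G - C) \<times> (pverts G - C) \<union> (C \<union> parcs G `` C) \<times> (C \<union> parcs G `` C)"
    if uv: "(u, v) \<in> parcs G" for u v
    using wellformed'[OF uv] uv arcs_symmetric[OF uv] by (cases "u \<in> C \<or> v \<in> C") auto
  ultimately show ?thesis
    using assms by (auto simp: separation_def)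
qed

subsection \<open>Relabeling\<close>

definition map_graph :: "('a \<Rightarrow> 'b) \<Rightarrow> 'a pair_pre_digraph \<Rightarrow> 'b pair_pre_digraph" where
  "map_graph f G = \<lparr>pverts = f ` pverts G, parcs = map_prod f f ` parcs G\<rparr>"

lemma map_graph_simps [simp]:
  "pverts (map_graph f G) = f ` pverts G"
  "parcs (map_graph f G) = map_prod f f ` parcs G"
  by (simp_all add: map_graph_def)

lemma (in pair_graph) obtain_inj_to_nat:
  obtains f :: "'a \<Rightarrow> nat" where "inj_on f (pverts G)"
  using finite_imp_inj_to_nat_seg[OF pair_finite_verts] by blast

lemma colorable_map_graphD:
  assumes "colorable k (map_graph f G)"
  shows "colorable k G"
proof -
  obtain c where "coloring k (map_graph f G) c"
    using assms unfolding colorable_iff_coloring by blast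
  then have "coloring k G (c \<circ> f)"
    by (force simp: coloring_def)
  then show ?thesis
    unfolding colorable_iff_coloring by blast
qed

lemma (in pair_wf_digraph) map_graph_inv_into:
  assumes "inj_on f (pverts G)"
  shows "map_graph (inv_into (pverts G) f) (map_graph f G) = G"
proof -
  let ?g = "inv_into (pverts G) f"
  have "map_prod ?g ?g (map_prod f f e) = e" if "e \<in> parcs G" for e
    using that assms by (cases e) (simp add: wellformed')
  then show ?thesis
    using assms by (simp add: map_graph_def image_image)
qed

lemma (in pair_bidirected_digraph) pair_bidirected_digraph_map_graph:
  assumes "inj_on f (pverts G)"
  shows "pair_bidirected_digraph (map_graph f G)"
proof
  fix e assume "e \<in> parcs (map_graph f G)"
  then obtain u v where uv: "(u, v) \<in> parcs G" and e: "e = (f u, f v)"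
    by auto
  then show "fst e \<noteq> snd e" "fst e \<in> pverts (map_graph f G)" "snd e \<in> pverts (map_graph f G)"
    using assms no_loops'[OF uv] wellformed'[OF uv] by (simp_all add: inj_on_eq_iff)
next
  show "symmetric (map_graph f G)"
    by (force simp: symmetric_def intro: symI arcs_symmetric)
qed

lemma (in pair_graph) pair_graph_map_graph:
  assumes "inj_on f (pverts G)"
  shows "pair_graph (map_graph f G)"
proof -
  interpret mapped: pair_bidirected_digraph "map_graph f G"
    using assms by (rule pair_bidirected_digraph_map_graph)
  show ?thesis
    by unfold_locales (simp_all add: pair_finite_verts pair_finite_arcs)
qed

lemma (in pair_wf_digraph) map_graph_pair_induce_subgraph:
  assumes "inj_on f (pverts G)" "S \<subseteq> pverts G"
  shows "map_graph f (G \<restriction>\<^sub>p S) = map_graph f G \<restriction>\<^sub>p (f ` S)"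
proof -
  have "inj_on (map_prod f f) (pverts G \<times> pverts G)"
    using assms(1) by (intro map_prod_inj_on)
  moreover have "parcs G \<subseteq> pverts G \<times> pverts G" "S \<times> S \<subseteq> pverts G \<times> pverts G"
    using assms(2) by (auto dest: wellformed')
  ultimately have "map_prod f f ` (parcs G \<inter> S \<times> S) = map_prod f f ` parcs G \<inter> map_prod f f ` (S \<times> S)"
    by (rule inj_on_image_Int)
  then show ?thesis
    by (simp add: pair_induce_subgraph_def map_prod_surj_on)
qed

lemma (in pair_graph) induced_subgraph_map_graph:
  assumes "inj_on f (pverts G)" "induced_subgraph (with_proj H) (with_proj G)"
  shows "induced_subgraph (with_proj (map_graph f H)) (with_proj (map_graph f G))"
proof -
  interpret mapped: pair_graph "map_graph f G"
    using assms(1) by (rule pair_graph_map_graph)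
  have H: "pverts H \<subseteq> pverts G" "H = G \<restriction>\<^sub>p pverts H"
    using assms(2) by (auto simp: induced_subgraph_pair_iff)
  then have "map_graph f H = map_graph f G \<restriction>\<^sub>p (f ` pverts H)"
    using map_graph_pair_induce_subgraph[OF assms(1) H(1)] by simp
  then show ?thesis
    using H(1) by (auto simp: mapped.induced_subgraph_pair_iff)
qed

lemma complete_digraph_map_graph:
  assumes "K\<^bsub>n\<^esub> (with_proj G)" "inj_on f (pverts G)"
  shows "K\<^bsub>n\<^esub> (with_proj (map_graph f G))"
proof -
  have "map_prod f f ` {(u, v). (u, v) \<in> pverts G \<times> pverts G \<and> u \<noteq> v} =
      {(u, v). (u, v) \<in> f ` pverts G \<times> f ` pverts G \<and> u \<noteq> v}"
    using assms(2) by (force simp: inj_on_def)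
  then show ?thesis
    using assms by (simp add: complete_digraph_pair_def card_image)
qed

lemma (in pair_wf_digraph) map_graph_subdivide:
  assumes "inj_on f (pverts G)" "(u, v) \<in> parcs G"
  shows "map_graph f (subdivide G (u, v) w) = subdivide (map_graph f G) (f u, f v) (f w)"
proof -
  have "inj_on (map_prod f f) (pverts G \<times> pverts G)"
    using assms(1) by (intro map_prod_inj_on)
  moreover have "parcs G - {(u, v), (v, u)} \<subseteq> pverts G \<times> pverts G"
    "{(u, v), (v, u)} \<subseteq> pverts G \<times> pverts G"
    using assms(2) by (auto dest: wellformed')
  ultimately have "map_prod f f ` (parcs G - {(u, v), (v, u)}) =
      map_prod f f ` parcs G - map_prod f f ` {(u, v), (v, u)}"
    by (rule inj_on_image_set_diff)
  then show ?thesis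
    by (simp add: map_graph_def subdivide.simps image_Un)
qed

lemma subdivision_pair_map_graph:
  assumes "subdivision_pair G H" "inj_on f (pverts H)"
  shows "subdivision_pair (map_graph f G) (map_graph f H)"
  using assms
proof (induction rule: subdivision_pair_induct)
  case base
  then show ?case
    by (intro subdivision_pair_base pair_bidirected_digraph.pair_bidirected_digraph_map_graph)
next
  case (divide e w H)
  interpret H: pair_bidirected_digraph H
    using divide.hyps(3) by (rule bidirected_digraphI_subdivision)
  obtain u v where e: "e = (u, v)"
    by (cases e)
  have inj: "inj_on f (insert w (pverts H))"
    using divide.prems by simp
  then have injH: "inj_on f (pverts H)"
    by (rule inj_on_subset) blast
  have "(f u, f v) \<in> parcs (map_graph f H)"
    using divide.hyps(1) e by force
  moreover have "f w \<notin> pverts (map_graph f H)"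
    using inj divide.hyps(2) by auto
  ultimately have "subdivision_pair (map_graph f G) (subdivide (map_graph f H) (f u, f v) (f w))"
    using divide.IH[OF injH] by (rule subdivision_pair_divide)
  then show ?case
    using H.map_graph_subdivide[OF injH] divide.hyps(1) by (simp add: e)
qed

lemma (in pair_graph) contains_triangle_map_graph:
  assumes "inj_on f (pverts G)" "contains_triangle G"
  shows "contains_triangle (map_graph f G)"
proof -
  obtain H where H: "induced_subgraph (with_proj H) (with_proj G)" "K\<^bsub>3\<^esub> (with_proj H)"
    using assms(2) unfolding contains_triangle_def by blast
  then have "inj_on f (pverts H)"
    using assms(1) by (auto simp: induced_subgraph_pair_iff intro: inj_on_subset)
  then show ?thesis
    unfolding contains_triangle_def
    using induced_subgraph_map_graph[OF assms(1) H(1)] complete_digraph_map_graph[OF H(2)] by blast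
qed

lemma (in pair_graph) contains_ISK4_map_graph:
  assumes "inj_on f (pverts G)" "contains_ISK4 G"
  shows "contains_ISK4 (map_graph f G)"
proof -
  obtain H K where H: "induced_subgraph (with_proj H) (with_proj G)"
    and K: "K\<^bsub>4\<^esub> (with_proj K)" "subdivision_pair K H"
    using assms(2) unfolding contains_ISK4_def ISK4_of_def by blast
  have inj: "inj_on f (pverts H)"
    using assms(1) H by (auto simp: induced_subgraph_pair_iff intro: inj_on_subset)
  moreover have "pverts K \<subseteq> pverts H"
    using subdivision_verts_subset[OF K(2)] by auto
  ultimately have "inj_on f (pverts K)"
    by (rule inj_on_subset)
  then show ?thesis
    unfolding contains_ISK4_def ISK4_of_def
    using induced_subgraph_map_graph[OF assms(1) H] complete_digraph_map_graph[OF K(1)]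
      subdivision_pair_map_graph[OF K(2) inj] by blast
qed

lemma (in pair_graph)
  assumes "inj_on f (pverts G)"
  shows contains_triangle_map_graph_iff: "contains_triangle (map_graph f G) \<longleftrightarrow> contains_triangle G"
    and contains_ISK4_map_graph_iff: "contains_ISK4 (map_graph f G) \<longleftrightarrow> contains_ISK4 G"
proof -
  let ?g = "inv_into (pverts G) f"
  interpret mapped: pair_graph "map_graph f G"
    using assms by (rule pair_graph_map_graph)
  have "inj_on ?g (pverts (map_graph f G))"
    by (simp add: inj_on_inv_into)
  note mapped.contains_triangle_map_graph[OF this] mapped.contains_ISK4_map_graph[OF this]
  then show "contains_triangle (map_graph f G) \<longleftrightarrow> contains_triangle G"
    "contains_ISK4 (map_graph f G) \<longleftrightarrow> contains_ISK4 G"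
    using contains_triangle_map_graph[OF assms] contains_ISK4_map_graph[OF assms]
    unfolding map_graph_inv_into[OF assms] by blast+
qed

subsection \<open>Walks and induced paths\<close>

lemma vwalk_iff_successively:
  "vwalk p G \<longleftrightarrow> p \<noteq> [] \<and> set p \<subseteq> verts G \<and> successively (\<lambda>u v. u \<rightarrow>\<^bsub>G\<^esub> v) p"
  by (induction p rule: induct_list012) (simp_all add: vwalk_def, blast)

lemma obtain_segment:
  assumes "u \<in> set xs" "v \<in> set xs"
  obtains us ms vs where "xs = us @ ms @ vs" "ms \<noteq> []"
    "hd ms = u \<and> last ms = v \<or> hd ms = v \<and> last ms = u"
proof -
  obtain us ws where xs: "xs = us @ u # ws"
    using assms(1) by (meson split_list)
  consider "v = u" | "v \<in> set ws" | "v \<in> set us"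
    using assms(2) xs by auto
  then show thesis
  proof cases
    case 1
    then show thesis
      using that[of us "[u]" ws] xs by simp
  next
    case 2
    then obtain ms vs where "ws = ms @ v # vs"
      by (meson split_list)
    then show thesis
      using that[of us "u # ms @ [v]" vs] xs by simp
  next
    case 3
    then obtain us' ms where "us = us' @ v # ms"
      by (meson split_list)
    then show thesis
      using that[of us' "v # ms @ [u]" ws] xs by simp
  qed
qed

definition path_arcs :: "'a list \<Rightarrow> 'a rel" where
  "path_arcs p = symcl (set (vwalk_arcs p))"

lemma path_arcs_simps [simp]:
  "path_arcs [] = {}"
  "path_arcs [x] = {}"
  "path_arcs (x # y # zs) = {(x, y), (y, x)} \<union> path_arcs (y # zs)"
  by (auto simp: path_arcs_def symcl_def)

lemma path_arcs_append_Cons2: "{(u, v), (v, u)} \<subseteq> path_arcs (us @ u # v # vs)"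
  by (induction us rule: induct_list012) auto

lemma path_arcs_subset: "path_arcs p \<subseteq> set p \<times> set p"
  by (auto simp: path_arcs_def symcl_def elim: in_set_vwalk_arcsE)

lemma (in pair_sym_digraph) path_arcs_subset_parcs:
  assumes "vwalk p G"
  shows "path_arcs p \<subseteq> parcs G"
  using assms arcs_symmetric by (auto simp: vwalk_def path_arcs_def symcl_def)

definition induced_path :: "'a pair_pre_digraph \<Rightarrow> 'a list \<Rightarrow> bool" where
  "induced_path G p \<longleftrightarrow>
     set p \<subseteq> pverts G \<and> distinct p \<and> parcs G \<inter> set p \<times> set p = path_arcs p"

lemma (in pair_bidirected_digraph) shortest_walk_induced_path:
  assumes walk: "vwalk p G"
    and shortest: "\<And>q. \<lbrakk>vwalk q G; hd q = hd p; last q = last p; set q \<subseteq> set p\<rbrakk>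
      \<Longrightarrow> length p \<le> length q"
  shows "induced_path G p"
proof -
  have "distinct p"
  proof (rule ccontr)
    assume "\<not> distinct p"
    then obtain us w ms vs where p: "p = us @ [w] @ ms @ [w] @ vs"
      using not_distinct_decomp by blast
    have "vwalk (us @ w # vs) G"
      using walk unfolding p
      by (auto simp: vwalk_iff_successively successively_append_iff successively_Cons)
    from shortest[OF this] show False
      unfolding p by (cases us) auto
  qed
  moreover have "parcs G \<inter> set p \<times> set p \<subseteq> path_arcs p"
  proof safe
    fix u v assume uv: "(u, v) \<in> parcs G" "u \<in> set p" "v \<in> set p"
    obtain us ms vs where p: "p = us @ ms @ vs" "ms \<noteq> []"
      and ends: "hd ms = u \<and> last ms = v \<or> hd ms = v \<and> last ms = u"
      using uv(2,3) by (rule obtain_segment)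
    define a b where "a = hd ms" and "b = last ms"
    have ab: "(a, b) \<in> parcs G"
      using ends uv(1) arcs_symmetric by (auto simp: a_def b_def)
    then obtain ns where ms: "ms = a # ns @ [b]"
      using p(2) no_loops' unfolding a_def b_def
      by (metis append_butlast_last_id last_ConsL last_ConsR list.collapse)
    have "vwalk (us @ a # b # vs) G"
      using walk ab unfolding p ms
      by (auto simp: vwalk_iff_successively successively_append_iff successively_Cons)
    from shortest[OF this] have "ns = []"
      unfolding p ms by (cases us) auto
    then show "(u, v) \<in> path_arcs p"
      using ends path_arcs_append_Cons2[of a b us vs] unfolding p ms by auto
  qed
  ultimately show ?thesis
    using walk path_arcs_subset[of p] path_arcs_subset_parcs[OF walk]
    by (auto simp: induced_path_def vwalk_def)
qed

subsection \<open>Components of induced subgraphs\<close>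

definition component :: "'a pair_pre_digraph \<Rightarrow> 'a set \<Rightarrow> 'a \<Rightarrow> 'a set" where
  "component G X v = {u. v \<rightarrow>\<^sup>*\<^bsub>with_proj (G \<restriction>\<^sub>p X)\<^esub> u}"

lemma (in pair_graph)
  assumes "X \<subseteq> pverts G"
  shows component_subset: "component G X v \<subseteq> X"
    and Image_component_subset: "parcs G `` component G X v \<subseteq> component G X v \<union> (pverts G - X)"
proof -
  interpret X: pair_graph "G \<restriction>\<^sub>p X"
    using assms by (rule pair_graph_pair_induce_subgraph)
  show subset: "component G X v \<subseteq> X"
    by (auto simp: component_def dest: X.reachable_in_verts(2))
  show "parcs G `` component G X v \<subseteq> component G X v \<union> (pverts G - X)"
  proof
    fix w assume "w \<in> parcs G `` component G X v"
    then obtain u where u: "u \<in> component G X v" "(u, w) \<in> parcs G"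
      by blast
    show "w \<in> component G X v \<union> (pverts G - X)"
    proof (cases "w \<in> X")
      case True
      then have "(u, w) \<in> parcs (G \<restriction>\<^sub>p X)"
        using u subset by auto
      then show ?thesis
        using u(1) by (auto simp: component_def intro: X.reachable_adj_trans)
    next
      case False
      then show ?thesis
        using wellformed'(2)[OF u(2)] by simp
    qed
  qed
qed

lemma (in pair_graph) component_obtain_walk:
  assumes "u \<in> component G X v" "w \<in> component G X v" "X \<subseteq> pverts G"
  obtains p where "vwalk p G" "set p \<subseteq> X" "hd p = u" "last p = w"
proof -
  interpret X: pair_graph "G \<restriction>\<^sub>p X"
    using assms(3) by (rule pair_graph_pair_induce_subgraph)
  have "u \<rightarrow>\<^sup>*\<^bsub>with_proj (G \<restriction>\<^sub>p X)\<^esub> w"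
    using assms(1,2) X.symmetric_reachable' X.reachable_trans unfolding component_def by blast
  then obtain p where p: "vwalk p (G \<restriction>\<^sub>p X)" "hd p = u" "last p = w"
    by (auto simp: X.reachable_vwalk_conv)
  then show thesis
    using assms(3) by (intro that[of p]) (auto simp: vwalk_def)
qed

subsection \<open>Subdivisions of \<open>K\<^sub>4\<close>\<close>

lemma subdivision_pair_replace_edge:
  assumes "subdivision_pair K G" "(u, v) \<in> parcs G" "distinct ws" "set ws \<inter> pverts G = {}"
  shows "subdivision_pair K
    \<lparr>pverts = pverts G \<union> set ws, parcs = parcs G - {(u, v), (v, u)} \<union> path_arcs (u # ws @ [v])\<rparr>"
  using assms
proof (induction ws arbitrary: G u)
  case Nil
  interpret pair_bidirected_digraph G
    using Nil.prems(1) by (rule bidirected_digraphI_subdivision)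
  have "G = \<lparr>pverts = pverts G, parcs = parcs G - {(u, v), (v, u)} \<union> {(u, v), (v, u)}\<rparr>"
    using Nil.prems(2) arcs_symmetric by (intro pair_pre_digraph.equality) auto
  then show ?case
    using Nil.prems(1) by simp
next
  case (Cons w ws)
  interpret pair_bidirected_digraph G
    using Cons.prems(1) by (rule bidirected_digraphI_subdivision)
  let ?G' = "subdivide G (u, v) w"
  have fresh: "(x, w) \<notin> parcs G" "(w, x) \<notin> parcs G" for x
    using Cons.prems(4) wellformed' by auto
  have uv: "u \<noteq> v" "w \<noteq> u" "w \<noteq> v"
    using Cons.prems(2,4) no_loops' wellformed' by auto
  have "subdivision_pair K ?G'"
    using Cons.prems by (intro subdivision_pair_divide) auto
  then have "subdivision_pair K \<lparr>pverts = pverts ?G' \<union> set ws,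
      parcs = parcs ?G' - {(w, v), (v, w)} \<union> path_arcs (w # ws @ [v])\<rparr>"
    using Cons.prems by (intro Cons.IH) auto
  moreover have "parcs ?G' - {(w, v), (v, w)} = parcs G - {(u, v), (v, u)} \<union> {(u, w), (w, u)}"
    using fresh uv by auto
  ultimately show ?case
    by (simp add: Un_assoc)
qed

lemma subdivision_pair_complete_refl:
  assumes "K\<^bsub>n\<^esub> (with_proj G)"
  shows "subdivision_pair G G"
proof -
  interpret pair_graph G
    using assms by (rule pair_graphI_complete)
  show ?thesis
    by (rule subdivision_pair_base) unfold_locales
qed

lemma complete_digraph_4I:
  assumes ne: "a \<noteq> a'" "b \<noteq> b'" and disjoint: "{a, a'} \<inter> {b, b'} = {}"
  shows "K\<^bsub>4\<^esub> (with_proj \<lparr>pverts = {a, a'} \<union> {b, b'},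
    parcs = {(a, a'), (a', a)} \<union> {(b, b'), (b', b)} \<union> ({a, a'} \<times> {b, b'} \<union> {b, b'} \<times> {a, a'})\<rparr>)"
proof -
  have "{(u, v). (u, v) \<in> ({a, a'} \<union> {b, b'}) \<times> ({a, a'} \<union> {b, b'}) \<and> u \<noteq> v} =
      ({a, a'} \<times> {a, a'} - Id) \<union> ({b, b'} \<times> {b, b'} - Id) \<union>
      ({a, a'} \<times> {b, b'} \<union> {b, b'} \<times> {a, a'})"
    using disjoint by blast
  also have "{a, a'} \<times> {a, a'} - Id = {(a, a'), (a', a)}"
    using ne(1) by auto
  also have "{b, b'} \<times> {b, b'} - Id = {(b, b'), (b', b)}"
    using ne(2) by auto
  finally show ?thesis
    using ne disjoint by (simp add: complete_digraph_pair_def)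
qed

lemma K4_subdivision_at_opposite_edges:
  fixes a a' b b' :: 'a
  assumes distinct: "distinct (a # ps @ [a'])" "distinct (b # qs @ [b'])"
    and disjoint: "set (a # ps @ [a']) \<inter> set (b # qs @ [b']) = {}"
  obtains K :: "'a pair_pre_digraph" where "K\<^bsub>4\<^esub> (with_proj K)" "subdivision_pair K
    \<lparr>pverts = set (a # ps @ [a']) \<union> set (b # qs @ [b']),
     parcs = path_arcs (a # ps @ [a']) \<union> path_arcs (b # qs @ [b']) \<union>
       ({a, a'} \<times> {b, b'} \<union> {b, b'} \<times> {a, a'})\<rparr>"
proof -
  let ?p = "a # ps @ [a']" and ?q = "b # qs @ [b']"
  let ?cross = "{a, a'} \<times> {b, b'} \<union> {b, b'} \<times> {a, a'}"
  define K where "K = \<lparr>pverts = {a, a'} \<union> {b, b'},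
    parcs = {(a, a'), (a', a)} \<union> {(b, b'), (b', b)} \<union> ?cross\<rparr>"
  have ne: "a \<noteq> a'" "b \<noteq> b'" "a \<noteq> b" "a \<noteq> b'" "a' \<noteq> b" "a' \<noteq> b'"
    using distinct disjoint by auto
  then have K4: "K\<^bsub>4\<^esub> (with_proj K)"
    unfolding K_def by (intro complete_digraph_4I) auto
  define I where
    "I = \<lparr>pverts = pverts K \<union> set ps, parcs = parcs K - {(a, a'), (a', a)} \<union> path_arcs ?p\<rparr>"
  have "subdivision_pair K I"
    unfolding I_def using distinct disjoint
    by (intro subdivision_pair_replace_edge[OF subdivision_pair_complete_refl[OF K4]])
      (auto simp: K_def)
  moreover have "(b, b') \<in> parcs I"
    using ne by (simp add: I_def K_def)
  moreover have "set qs \<inter> pverts I = {}"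
    using distinct disjoint by (auto simp: I_def K_def)
  ultimately have "subdivision_pair K
      \<lparr>pverts = pverts I \<union> set qs, parcs = parcs I - {(b, b'), (b', b)} \<union> path_arcs ?q\<rparr>"
    using distinct(2) by (intro subdivision_pair_replace_edge) auto
  moreover have "pverts I \<union> set qs = set ?p \<union> set ?q"
    by (auto simp: I_def K_def)
  moreover have "parcs I - {(b, b'), (b', b)} \<union> path_arcs ?q =
      path_arcs ?p \<union> path_arcs ?q \<union> ?cross"
  proof -
    have "parcs K - {(a, a'), (a', a)} - {(b, b'), (b', b)} = ?cross"
      using ne by (simp add: K_def insert_Diff_if)
    moreover have "path_arcs ?p \<inter> {(b, b'), (b', b)} = {}"
      using disjoint path_arcs_subset[of ?p] by auto
    ultimately show ?thesis
      unfolding I_def pair_pre_digraph.simps by blast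
  qed
  ultimately show thesis
    using that[OF K4] by (simp only:)
qed

lemma (in pair_graph) contains_ISK4_if_two_induced_paths:
  assumes p: "induced_path G (a # ps @ [a'])" and q: "induced_path G (b # qs @ [b'])"
    and disjoint: "set (a # ps @ [a']) \<inter> set (b # qs @ [b']) = {}"
    and cross: "parcs G \<inter> set (a # ps @ [a']) \<times> set (b # qs @ [b']) = {a, a'} \<times> {b, b'}"
  shows "contains_ISK4 G"
proof -
  let ?p = "a # ps @ [a']" and ?q = "b # qs @ [b']"
  let ?H = "G \<restriction>\<^sub>p (set ?p \<union> set ?q)"
  have cross': "parcs G \<inter> set ?q \<times> set ?p = {b, b'} \<times> {a, a'}"
    using cross arcs_symmetric by blast
  have "parcs G \<inter> (set ?p \<union> set ?q) \<times> (set ?p \<union> set ?q) =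
      (parcs G \<inter> set ?p \<times> set ?p) \<union> (parcs G \<inter> set ?q \<times> set ?q) \<union>
      ((parcs G \<inter> set ?p \<times> set ?q) \<union> (parcs G \<inter> set ?q \<times> set ?p))"
    by blast
  also have "\<dots> = path_arcs ?p \<union> path_arcs ?q \<union> ({a, a'} \<times> {b, b'} \<union> {b, b'} \<times> {a, a'})"
    unfolding cross cross' using p q by (simp add: induced_path_def)
  finally have H: "?H = \<lparr>pverts = set ?p \<union> set ?q,
      parcs = path_arcs ?p \<union> path_arcs ?q \<union> ({a, a'} \<times> {b, b'} \<union> {b, b'} \<times> {a, a'})\<rparr>"
    by (simp only: pair_induce_subgraph_def)
  obtain K :: "'a pair_pre_digraph" where "K\<^bsub>4\<^esub> (with_proj K)" "subdivision_pair K ?H"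
    unfolding H using p q disjoint
    by (elim K4_subdivision_at_opposite_edges[rotated 2]) (auto simp only: induced_path_def)
  moreover have "induced_subgraph (with_proj ?H) (with_proj G)"
    using p q by (auto simp: induced_subgraph_pair_iff induced_path_def)
  ultimately show ?thesis
    unfolding contains_ISK4_def ISK4_of_def by blast
qed

subsection \<open>Maximal bicliques in triangle-free graphs\<close>

locale triangle_free_graph = pair_graph +
  assumes triangle_free: "\<not> contains_triangle G"
begin

lemma no_triangle:
  assumes "(a, b) \<in> parcs G" "(b, c) \<in> parcs G"
  shows "(a, c) \<notin> parcs G"
proof
  assume ac: "(a, c) \<in> parcs G"
  let ?H = "G \<restriction>\<^sub>p {a, b, c}"
  have "induced_subgraph (with_proj ?H) (with_proj G)"
    using assms wellformed' by (auto simp: induced_subgraph_pair_iff)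
  moreover have "K\<^bsub>3\<^esub> (with_proj ?H)"
    using assms ac assms[THEN arcs_symmetric] arcs_symmetric[OF ac] no_loops'
    by (auto simp: complete_digraph_pair_def)
  ultimately show False
    using triangle_free unfolding contains_triangle_def by blast
qed

end

definition biclique :: "'a pair_pre_digraph \<Rightarrow> 'a set \<Rightarrow> 'a set \<Rightarrow> bool" where
  "biclique G A B \<longleftrightarrow> A \<subseteq> pverts G \<and> B \<subseteq> pverts G \<and> A \<times> B \<subseteq> parcs G"

lemma (in pair_sym_digraph) biclique_commute: "biclique G A B \<longleftrightarrow> biclique G B A"
  by (auto simp: biclique_def intro: arcs_symmetric)

locale maximal_biclique = triangle_free_graph +
  fixes A B :: "'a set"
  assumes biclique: "biclique G A B"
    and maximal: "\<lbrakk>biclique G A' B'; A \<subseteq> A'; B \<subseteq> B'\<rbrakk> \<Longrightarrow> A' = A \<and> B' = B"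
    and card_ge_3: "3 \<le> card A" "3 \<le> card B"

lemma (in maximal_biclique) maximal_biclique_swap: "maximal_biclique G B A"
proof
  show "biclique G B A"
    using biclique by (simp add: biclique_commute)
  show "A' = B \<and> B' = A" if "biclique G A' B'" "B \<subseteq> A'" "A \<subseteq> B'" for A' B'
    using that maximal[of B' A'] by (simp add: biclique_commute)
qed (fact card_ge_3)+

lemma (in triangle_free_graph) ex_maximal_biclique:
  assumes "contains_K33 G"
  obtains A B where "maximal_biclique G A B"
proof -
  define P where "P = (\<lambda>(A, B). biclique G A B \<and> 3 \<le> card A \<and> 3 \<le> card B)"
  define size where "size = (\<lambda>(A :: 'a set, B :: 'a set). card A + card B)"
  obtain H where H: "pverts H \<subseteq> pverts G" "H = G \<restriction>\<^sub>p pverts H" and K33: "K\<^bsub>3,3\<^esub> (with_proj H)"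
    using assms unfolding contains_K33_def induced_subgraph_pair_iff by blast
  obtain U W where UW: "pverts H = U \<union> W" "card U = 3" "card W = 3" "parcs H = U \<times> W \<union> W \<times> U"
    using K33 unfolding complete_bipartite_digraph_pair_def by blast
  have "parcs H \<subseteq> parcs G"
    by (subst H(2)) simp
  then have "P (U, W)"
    using H(1) UW by (simp add: P_def biclique_def)
  moreover have "size p < 2 * card (pverts G) + 1" if "P p" for p
    using that card_mono[OF pair_finite_verts, of "fst p"] card_mono[OF pair_finite_verts, of "snd p"]
    by (auto simp: P_def size_def biclique_def)
  ultimately obtain A B where AB: "P (A, B)" and greatest: "\<And>p. P p \<Longrightarrow> size p \<le> size (A, B)"
    using ex_has_greatest_nat[of P _ size] by (metis surj_pair)
  have "A' = A \<and> B' = B" if AB': "biclique G A' B'" "A \<subseteq> A'" "B \<subseteq> B'" for A' B'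
  proof -
    have fin: "finite A'" "finite B'"
      using AB'(1) finite_subset[OF _ pair_finite_verts] by (auto simp: biclique_def)
    have "P (A', B')"
      using AB AB' fin card_mono[of A' A] card_mono[of B' B] by (simp add: P_def)
    then have "card A' + card B' \<le> card A + card B"
      using greatest by (force simp: size_def)
    moreover have "card A \<le> card A'" "card B \<le> card B'"
      using AB'(2,3) fin by (auto intro: card_mono)
    ultimately show ?thesis
      using AB'(2,3) fin card_seteq[of A' A] card_seteq[of B' B] by simp
  qed
  then have "maximal_biclique G A B"
    using AB by unfold_locales (auto simp: P_def)
  then show thesis
    by (rule that)
qed

lemma (in maximal_biclique) finite_sides: "finite A" "finite B"
  using card_ge_3 by (auto intro: card_ge_0_finite)

lemma (in maximal_biclique) adjacent:
  assumes "a \<in> A" "b \<in> B"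
  shows "(a, b) \<in> parcs G" "(b, a) \<in> parcs G"
  using assms biclique arcs_symmetric[of a b] by (auto simp: biclique_def)

lemma (in maximal_biclique) side_independent:
  assumes "a \<in> A" "a' \<in> A"
  shows "(a, a') \<notin> parcs G"
proof -
  obtain b where "b \<in> B"
    using card_ge_3 by fastforce
  then show ?thesis
    using assms adjacent by (intro no_triangle[of a b a'])
qed

lemma (in maximal_biclique) other_side_independent:
  assumes "b \<in> B" "b' \<in> B"
  shows "(b, b') \<notin> parcs G"
  using maximal_biclique_swap assms by (rule maximal_biclique.side_independent)

lemma (in maximal_biclique) sides_disjoint: "A \<inter> B = {}"
  using adjacent no_loops' by blast

lemma (in maximal_biclique) ex_nonadjacent_in_side:
  assumes "v \<in> pverts G - (A \<union> B)"
  obtains a where "a \<in> A" "(v, a) \<notin> parcs G"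
proof (rule ccontr)
  assume "\<not> thesis"
  then have "\<forall>a \<in> A. (a, v) \<in> parcs G"
    using that arcs_symmetric by blast
  then have "biclique G A (insert v B)"
    using assms biclique by (auto simp: biclique_def)
  then show False
    using maximal[of A "insert v B"] assms by auto
qed

lemma (in maximal_biclique) colorable_if_spanning:
  assumes "pverts G = A \<union> B" "2 \<le> k"
  shows "colorable k G"
proof (rule colorable_bipartition[OF assms(1) sides_disjoint _ assms(2)])
  show "parcs G \<subseteq> A \<times> B \<union> B \<times> A"
  proof (rule subrelI)
    fix u v assume uv: "(u, v) \<in> parcs G"
    then have "u \<in> A \<union> B" "v \<in> A \<union> B"
      using wellformed' assms(1) by blast+
    then show "(u, v) \<in> A \<times> B \<union> B \<times> A"
      using uv side_independent other_side_independent by blast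
  qed
qed

subsection \<open>Walks linking two vertices of a maximal biclique\<close>

definition linking_walk :: "'a pair_pre_digraph \<Rightarrow> 'a set \<Rightarrow> 'a set \<Rightarrow> 'a list \<Rightarrow> bool" where
  "linking_walk G A B p \<longleftrightarrow> vwalk p (with_proj G) \<and> hd p \<in> A \<and> last p \<in> A \<and> hd p \<noteq> last p \<and>
     set p \<inter> (A \<union> B) \<subseteq> {hd p, last p}"

lemma linking_walk_subset:
  assumes "linking_walk G A B p"
    and "vwalk q (with_proj G)" "hd q = hd p" "last q = last p" "set q \<subseteq> set p"
  shows "linking_walk G A B q"
  using assms by (auto simp: linking_walk_def)

lemma (in maximal_biclique) linking_walkI:
  assumes "a \<in> A" "a' \<in> A" "a \<noteq> a'"
    and "ms \<noteq> []" "set ms \<subseteq> pverts G - (A \<union> B)" "successively (\<lambda>u v. (u, v) \<in> parcs G) ms"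
    and "(hd ms, a) \<in> parcs G" "(last ms, a') \<in> parcs G"
  shows "linking_walk G A B (a # ms @ [a'])"
proof -
  have "(a, hd ms) \<in> parcs G"
    using assms(7) by (rule arcs_symmetric)
  then have "vwalk (a # ms @ [a']) G"
    using assms biclique
    by (auto simp: vwalk_iff_successively successively_append_iff successively_Cons biclique_def)
  then show ?thesis
    using assms by (auto simp: linking_walk_def)
qed

locale shortest_linking_walk = maximal_biclique +
  fixes x ps y
  assumes linking: "linking_walk G A B (x # ps @ [y])"
    and shortest: "linking_walk G A B q \<Longrightarrow> length (x # ps @ [y]) \<le> length q"
    and shortest_swap: "linking_walk G B A q \<Longrightarrow> length (x # ps @ [y]) \<le> length q"
begin

lemma ends: "x \<in> A" "y \<in> A" "x \<noteq> y"
  using linking by (auto simp: linking_walk_def)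

lemma walk: "vwalk (x # ps @ [y]) G"
  using linking by (simp add: linking_walk_def)

lemma walk_induced_path: "induced_path G (x # ps @ [y])"
proof (rule shortest_walk_induced_path[OF walk])
  fix q assume "vwalk q G" "hd q = hd (x # ps @ [y])" "last q = last (x # ps @ [y])"
    "set q \<subseteq> set (x # ps @ [y])"
  with linking have "linking_walk G A B q"
    by (rule linking_walk_subset)
  then show "length (x # ps @ [y]) \<le> length q"
    by (rule shortest)
qed

lemma interior_outside: "set ps \<subseteq> pverts G - (A \<union> B)"
  using walk_induced_path linking by (auto simp: induced_path_def linking_walk_def)

lemma interior_nonempty: "ps \<noteq> []"
  using walk side_independent[OF ends(1,2)] by auto

lemma interior_successively: "successively (\<lambda>u v. (u, v) \<in> parcs G) ps"
  and hd_interior_adjacent: "(hd ps, x) \<in> parcs G"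
  and last_interior_adjacent: "(last ps, y) \<in> parcs G"
proof -
  have "successively (\<lambda>u v. (u, v) \<in> parcs G) (x # ps @ [y])"
    using walk by (simp add: vwalk_iff_successively)
  then show "successively (\<lambda>u v. (u, v) \<in> parcs G) ps"
    "(hd ps, x) \<in> parcs G" "(last ps, y) \<in> parcs G"
    using interior_nonempty
    by (auto simp: successively_append_iff successively_Cons intro: arcs_symmetric)
qed

lemma attached_segment_eq_interior:
  assumes ps: "ps = us @ ms @ vs" and "ms \<noteq> []"
    and "{c, d} \<subseteq> A \<or> {c, d} \<subseteq> B" "c \<noteq> d" "(hd ms, c) \<in> parcs G" "(last ms, d) \<in> parcs G"
  shows "ms = ps"
proof -
  have "set ms \<subseteq> pverts G - (A \<union> B)" "successively (\<lambda>u v. (u, v) \<in> parcs G) ms"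
    using ps interior_outside interior_successively by (auto simp: successively_append_iff)
  then have "linking_walk G A B (c # ms @ [d]) \<or> linking_walk G B A (c # ms @ [d])"
    using assms(2-) linking_walkI[of c d ms]
      maximal_biclique.linking_walkI[OF maximal_biclique_swap, of c d ms] by (auto simp: Un_commute)
  then show ?thesis
    using shortest[of "c # ms @ [d]"] shortest_swap[of "c # ms @ [d]"] ps by auto
qed

lemma ex_third_vertex:
  obtains a where "a \<in> A" "a \<noteq> x" "a \<noteq> y" "\<And>w. w \<in> set ps \<Longrightarrow> (w, a) \<notin> parcs G"
proof (cases "\<exists>w. ps = [w]")
  case True
  then obtain w where ps: "ps = [w]"
    by blast
  then obtain a where "a \<in> A" "(w, a) \<notin> parcs G"
    using ex_nonadjacent_in_side[of w] interior_outside by auto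
  then show thesis
    using that[of a] hd_interior_adjacent last_interior_adjacent unfolding ps by auto
next
  case False
  have "card {x, y} < card A"
    using card_ge_3 ends(3) by simp
  then obtain a where a: "a \<in> A" "a \<noteq> x" "a \<noteq> y"
    using card_mono[of "{x, y}" A] by fastforce
  have "(w, a) \<notin> parcs G" if w: "w \<in> set ps" for w
  proof
    assume wa: "(w, a) \<in> parcs G"
    obtain us vs where ps: "ps = us @ w # vs"
      using w by (meson split_list)
    have "hd (us @ [w]) = hd ps"
      using ps by (cases us) simp_all
    then have "us @ [w] = ps"
      using ps ends(1) a wa hd_interior_adjacent
      by (intro attached_segment_eq_interior[of "[]" "us @ [w]" vs x a]) simp_all
    then have "vs = []"
      unfolding ps by simp
    have "w # vs = ps"
      using ps ends(2) a wa last_interior_adjacent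
      by (intro attached_segment_eq_interior[of us "w # vs" "[]" a y]) simp_all
    then have "us = []"
      unfolding ps by simp
    then show False
      using False ps \<open>vs = []\<close> by simp
  qed
  with a show thesis
    by (rule that)
qed

lemma attachment_to_other_side_unique:
  assumes "b \<in> B" "b' \<in> B" "w \<in> set ps" "w' \<in> set ps" "(w, b) \<in> parcs G" "(w', b') \<in> parcs G"
  shows "b = b'"
proof (rule ccontr)
  assume "b \<noteq> b'"
  obtain us ms vs where ms: "ps = us @ ms @ vs" "ms \<noteq> []"
    and "hd ms = w \<and> last ms = w' \<or> hd ms = w' \<and> last ms = w"
    using assms(3,4) by (rule obtain_segment)
  then obtain c d where cd: "c \<in> B" "d \<in> B" "c \<noteq> d" "(hd ms, c) \<in> parcs G" "(last ms, d) \<in> parcs G"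
    using assms \<open>b \<noteq> b'\<close> by metis
  then have "ms = ps"
    by (intro attached_segment_eq_interior[OF ms]) simp_all
  \<comment> \<open>The first vertex of \<open>ps\<close> is thus adjacent to both ends of the edge between \<open>x\<close> and \<open>c\<close>.\<close>
  then have "(x, c) \<notin> parcs G"
    using no_triangle[OF arcs_symmetric[OF hd_interior_adjacent]] cd(4) by simp
  then show False
    using ends(1) cd(1) adjacent by simp
qed

lemma ex_two_unattached_in_other_side:
  obtains b b' where "b \<in> B" "b' \<in> B" "b \<noteq> b'"
    "\<And>w. w \<in> set ps \<Longrightarrow> (w, b) \<notin> parcs G" "\<And>w. w \<in> set ps \<Longrightarrow> (w, b') \<notin> parcs G"
proof -
  define U where "U = {b \<in> B. \<exists>w \<in> set ps. (w, b) \<in> parcs G}"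
  have "finite U"
    using finite_sides(2) by (simp add: U_def)
  then have "card U \<le> 1"
    using attachment_to_other_side_unique by (auto simp: card_le_Suc0_iff_eq U_def)
  then have "2 \<le> card (B - U)"
    using card_ge_3(2) \<open>finite U\<close> by (subst card_Diff_subset) (auto simp: U_def)
  then obtain b b' where "b \<in> B - U" "b' \<in> B - U" "b \<noteq> b'"
    using card_le_Suc0_iff_eq[of "B - U"] finite_sides(2) by fastforce
  then show thesis
    using that[of b b'] by (auto simp: U_def)
qed

lemma contains_ISK4: "contains_ISK4 G"
proof -
  obtain a where a: "a \<in> A" "a \<noteq> x" "a \<noteq> y" "\<And>w. w \<in> set ps \<Longrightarrow> (w, a) \<notin> parcs G"
    using ex_third_vertex by blast
  obtain b b' where b: "b \<in> B" "b' \<in> B" "b \<noteq> b'"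
    "\<And>w. w \<in> set ps \<Longrightarrow> (w, b) \<notin> parcs G" "\<And>w. w \<in> set ps \<Longrightarrow> (w, b') \<notin> parcs G"
    using ex_two_unattached_in_other_side by blast
  show ?thesis
  proof (rule contains_ISK4_if_two_induced_paths)
    show "induced_path G (x # ps @ [y])"
      by (rule walk_induced_path)
    have "(a, b) \<in> parcs G" "(a, b') \<in> parcs G" "(b, a) \<in> parcs G" "(b', a) \<in> parcs G"
      "(a, a) \<notin> parcs G" "parcs G \<inter> {b, b'} \<times> {b, b'} = {}"
      using a(1) b(1,2) adjacent side_independent other_side_independent by auto
    moreover have "a \<noteq> b" "a \<noteq> b'"
      using a(1) b(1,2) sides_disjoint by auto
    ultimately show "induced_path G (b # [a] @ [b'])"
      using b(3) wellformed' unfolding induced_path_def by auto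
    show "set (x # ps @ [y]) \<inter> set (b # [a] @ [b']) = {}"
      using a b ends interior_outside sides_disjoint by auto
    show "parcs G \<inter> set (x # ps @ [y]) \<times> set (b # [a] @ [b']) = {x, y} \<times> {b, b'}"
      using a b ends adjacent side_independent by auto
  qed
qed

end

lemma linking_walk_contains_ISK4:
  assumes "maximal_biclique G A B" "linking_walk G A B p"
  shows "contains_ISK4 G"
  using assms
proof (induction p arbitrary: A B rule: measure_induct_rule[of length])
  case (less p)
  obtain x ps y where p: "p = x # ps @ [y]"
    using less.prems(2) unfolding linking_walk_def vwalk_def
    by (metis append_butlast_last_id hd_Cons_tl last.simps)
  show ?case
  proof (rule ccontr)
    assume "\<not> contains_ISK4 G"
    then have "length p \<le> length q" if "linking_walk G A B q \<or> linking_walk G B A q" for q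
      using that less.IH less.prems(1) maximal_biclique.maximal_biclique_swap not_le by blast
    then have "shortest_linking_walk G A B x ps y"
      using less.prems unfolding p
      by (simp add: shortest_linking_walk_def shortest_linking_walk_axioms_def)
    then have "contains_ISK4 G"
      by (rule shortest_linking_walk.contains_ISK4)
    with \<open>\<not> contains_ISK4 G\<close> show False
      by contradiction
  qed
qed

subsection \<open>Clique separations\<close>

lemma (in maximal_biclique) component_attachment_unique:
  assumes "\<not> contains_ISK4 G" and C: "C = component G (pverts G - (A \<union> B)) v"
    and "a \<in> A" "a' \<in> A" "a \<in> parcs G `` C" "a' \<in> parcs G `` C"
  shows "a = a'"
proof (rule ccontr)
  assume "a \<noteq> a'"
  obtain c d where cd: "c \<in> C" "(c, a) \<in> parcs G" "d \<in> C" "(d, a') \<in> parcs G"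
    using assms(5,6) by blast
  obtain ms where ms: "vwalk ms G" "set ms \<subseteq> pverts G - (A \<union> B)" "hd ms = c" "last ms = d"
    using component_obtain_walk cd(1,3) unfolding C by blast
  then have "linking_walk G A B (a # ms @ [a'])"
    using assms(3,4) cd(2,4) \<open>a \<noteq> a'\<close> by (intro linking_walkI) (auto simp: vwalk_iff_successively)
  then show False
    using assms(1) linking_walk_contains_ISK4 maximal_biclique_axioms by blast
qed

lemma (in maximal_biclique) component_attachments_clique:
  assumes "\<not> contains_ISK4 G" and C: "C = component G (pverts G - (A \<union> B)) v"
  shows "clique G (parcs G `` C - C)"
  unfolding clique_def
proof (intro ballI impI)
  fix x y assume xy: "x \<in> parcs G `` C - C" "y \<in> parcs G `` C - C" "x \<noteq> y"
  have "parcs G `` C - C \<subseteq> A \<union> B"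
    using Image_component_subset[of "pverts G - (A \<union> B)" v] unfolding C by blast
  moreover have "\<not> (x \<in> A \<and> y \<in> A)"
    using component_attachment_unique[OF assms] xy by blast
  moreover have "\<not> (x \<in> B \<and> y \<in> B)"
    using maximal_biclique.component_attachment_unique[OF maximal_biclique_swap assms(1), of C v] C xy
    by (auto simp: Un_commute)
  ultimately have "x \<in> A \<and> y \<in> B \<or> x \<in> B \<and> y \<in> A"
    using xy by blast
  then show "(x, y) \<in> parcs G"
    using adjacent by auto
qed

lemma (in maximal_biclique) ex_clique_separation:
  assumes no_ISK4: "\<not> contains_ISK4 G" and "pverts G \<noteq> A \<union> B"
  obtains S T where "separation G S T" "clique G (S \<inter> T)" "S \<subset> pverts G" "T \<subset> pverts G"
proof -
  obtain v where v: "v \<in> pverts G - (A \<union> B)"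
    using assms(2) biclique by (auto simp: biclique_def)
  define C where "C = component G (pverts G - (A \<union> B)) v"
  have C: "C \<subseteq> pverts G - (A \<union> B)" "parcs G `` C \<subseteq> pverts G" "v \<in> C"
    using component_subset[of "pverts G - (A \<union> B)" v] v wellformed'(2)
    by (auto simp: C_def component_def reachable_def)
  show thesis
  proof (rule that)
    show "separation G (pverts G - C) (C \<union> parcs G `` C)"
      using C(1) by (intro separation_Image) blast
    have "(pverts G - C) \<inter> (C \<union> parcs G `` C) = parcs G `` C - C"
      using C(2) by blast
    then show "clique G ((pverts G - C) \<inter> (C \<union> parcs G `` C))"
      using component_attachments_clique[OF no_ISK4 C_def] by simp
    show "pverts G - C \<subset> pverts G"
      using C(1,3) by blast
    have "card (A \<inter> parcs G `` C) \<le> 1"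
      using component_attachment_unique[OF no_ISK4 C_def] finite_sides(1)
      by (auto simp: card_le_Suc0_iff_eq)
    then have "\<not> A \<subseteq> parcs G `` C"
      using card_ge_3 by (auto simp: Int_absorb2)
    then show "C \<union> parcs G `` C \<subset> pverts G"
      using C(1,2) biclique by (auto simp: biclique_def)
  qed
qed

lemma (in triangle_free_graph) colorable_if_contains_K33:
  assumes "\<not> contains_ISK4 G" "contains_K33 G" "2 \<le> k"
    and smaller: "\<And>S. S \<subset> pverts G \<Longrightarrow> colorable k (G \<restriction>\<^sub>p S)"
  shows "colorable k G"
proof -
  obtain A B where max: "maximal_biclique G A B"
    using assms(2) by (rule ex_maximal_biclique)
  show ?thesis
  proof (cases "pverts G = A \<union> B")
    case True
    with max show ?thesis
      using assms(3) by (rule maximal_biclique.colorable_if_spanning)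
  next
    case False
    with max assms(1) obtain S T where ST: "separation G S T" "clique G (S \<inter> T)"
      and "S \<subset> pverts G" "T \<subset> pverts G"
      by (rule maximal_biclique.ex_clique_separation)
    then have "colorable k (G \<restriction>\<^sub>p S)" "colorable k (G \<restriction>\<^sub>p T)"
      by (simp_all add: smaller)
    with ST show ?thesis
      by (rule colorable_clique_separation)
  qed
qed

lemma colorable_3_if_triangle_ISK4_free:
  fixes G :: "'a pair_pre_digraph"
  assumes "\<And>G :: 'a pair_pre_digraph. \<lbrakk>pair_graph G; pverts G \<noteq> {};
      \<not> contains_triangle G; \<not> contains_ISK4 G; \<not> contains_K33 G\<rbrakk>
      \<Longrightarrow> \<exists>v \<in> pverts G. degree G v \<le> 2"
    and "pair_graph G" "\<not> contains_triangle G" "\<not> contains_ISK4 G"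
  shows "colorable 3 G"
  using assms(2-)
proof (induction "card (pverts G)" arbitrary: G rule: less_induct)
  case less
  note G = \<open>pair_graph G\<close>
  have smaller: "colorable 3 (G \<restriction>\<^sub>p S)" if S: "S \<subset> pverts G" for S
  proof (rule less.hyps)
    show "card (pverts (G \<restriction>\<^sub>p S)) < card (pverts G)"
      using pair_graph.card_psubset_pverts[OF G S] by simp
    show "pair_graph (G \<restriction>\<^sub>p S)"
      using S by (intro pair_graph.pair_graph_pair_induce_subgraph[OF G]) blast
    have "induced_subgraph (with_proj (G \<restriction>\<^sub>p S)) (with_proj G)"
      using S by (intro pair_graph.induced_subgraph_pair_induce[OF G]) blast
    then show "\<not> contains_triangle (G \<restriction>\<^sub>p S)" "\<not> contains_ISK4 (G \<restriction>\<^sub>p S)"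
      using less.prems contains_triangle_induced_subgraph contains_ISK4_induced_subgraph by blast+
  qed
  consider (null) "pverts G = {}" | (low_degree) "pverts G \<noteq> {}" "\<not> contains_K33 G"
    | (K33) "contains_K33 G"
    by blast
  then show ?case
  proof cases
    case null
    with G show ?thesis
      by (rule pair_graph.colorable_null)
  next
    case low_degree
    then obtain v where "v \<in> pverts G" "degree G v \<le> 2"
      using assms(1) less.prems by blast
    then show ?thesis
      by (intro pair_graph.colorable_remove_vertex[OF G, of v] smaller) auto
  next
    case K33
    have "triangle_free_graph G"
      using less.prems by (simp add: triangle_free_graph_def triangle_free_graph_axioms_def)
    from this less.prems(3) K33 show ?thesis
      by (rule triangle_free_graph.colorable_if_contains_K33) (simp_all add: smaller)
  qed
qed

theorem theorem2p7:
  assumes "\<forall>G :: nat pair_pre_digraph.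
      pair_graph G \<and> pverts G \<noteq> {} \<and>
      \<not> contains_triangle G \<and> \<not> contains_ISK4 G \<and> \<not> contains_K33 G
      \<longrightarrow> (\<exists>v \<in> pverts G. degree G v \<le> 2)"
  shows "\<forall>G :: 'a pair_pre_digraph.
      pair_graph G \<and> \<not> contains_triangle G \<and> \<not> contains_ISK4 G
      \<longrightarrow> colorable 3 G"
proof (intro allI impI, elim conjE)
  fix G :: "'a pair_pre_digraph"
  assume G: "pair_graph G" and free: "\<not> contains_triangle G" "\<not> contains_ISK4 G"
  obtain f :: "'a \<Rightarrow> nat" where f: "inj_on f (pverts G)"
    using G by (rule pair_graph.obtain_inj_to_nat)
  have "colorable 3 (map_graph f G)"
  proof (rule colorable_3_if_triangle_ISK4_free)
    show "pair_graph (map_graph f G)"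
      using G f by (rule pair_graph.pair_graph_map_graph)
    show "\<not> contains_triangle (map_graph f G)" "\<not> contains_ISK4 (map_graph f G)"
      using free pair_graph.contains_triangle_map_graph_iff[OF G f]
        pair_graph.contains_ISK4_map_graph_iff[OF G f] by simp_all
  qed (use assms in blast)
  then show "colorable 3 G"
    by (rule colorable_map_graphD)
qed

end
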